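(* Let $\varphi:\Sigma\to\Delta$ be a combinatorial morphism of posets and $m_\varphi:\Sigma\to\mathbb Z_{\ge1}$ a map. Assume that $\Delta$ is connected. Then the pair $(\varphi,m_\varphi)$ is an indexed branched cover with branch locus contained in the complement of $\max\Delta$ if and only if $(\varphi,m_\varphi)$ is balanced.
   Context: Posets carry the topology whose open sets are the up-closed sets (up-sets); connectedness refers to this topology. $\max\Delta$ is the set of maximal elements of $\Delta$. $\downarrow_\Sigma\alpha=\{\gamma\in\Sigma:\gamma\le\alpha\}$. A morphism of posets is an order-preserving map. A morphism of posets $\varphi:\Sigma\to\Delta$ is combinatorial if $\Sigma$ and $\Delta$ are finite and, for all $\alpha\in\Sigma$, $\varphi$ maps $\downarrow_\Sigma\alpha$ isomorphically (as posets) onto $\downarrow_\Delta\varphi(\alpha)$. We write $\alpha\lessdot\gamma$ if $\gamma$ covers $\alpha$, i.e. $\alpha<\gamma$ and there is no element strictly between. Balanced: $(\varphi,m_\varphi)$ is balanced if for every $\alpha\in\Sigma$ and every $\beta\in\Delta$ with $\varphi(\alpha)\lessdot\beta$ one has $m_\varphi(\alpha)=\sum_{\gamma\in\varphi^{-1}(\beta),\ \alpha\lessdot\gamma}m_\varphi(\gamma)$ (empty sums are $0$). Indexed branched cover: a continuous map $F:X\to Y$ is a cover if every $y\in Y$ has a neighbourhood $U$ whose preimage is a disjoint union of copies of $U$ (each mapped homeomorphically to $U$). $F$ is a branched cover with branch locus a closed set $B\subset Y$ if $Y\setminus B$ is open and dense and $F$ restricted to $F^{-1}(Y\setminus B)\to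 Y\setminus B$ is a cover. For $F$ with finite fibres, $m_X:X\to\mathbb Z_{\ge1}$ and $V\subset X$ let $\deg(F,m_X,V)(y)=\sum_{x\in F^{-1}(y)\cap V}m_X(x)$ (empty sums are $0$). $(F,m_X)$ is an indexed branched cover with branch locus $B$ if $F$ is a branched cover with branch locus $B$ and for every connected open $U\subset Y$ and every connected component $V$ of $F^{-1}(U)$ the function $\deg(F,m_X,V)$ is constant on $U$. *)

theory Defs
  imports "HOL-Analysis.Analysis"
begin

text \<open>
  A poset is a carrier set in a type of class \<^class>\<open>order\<close> with the induced order; unlike a whole
  type, a carrier may be empty.
\<close>

definition upset_topology :: "'a::order set \<Rightarrow> 'a topology" where
  "upset_topology S = topology (\<lambda>U. U \<subseteq> S \<and> (\<forall>x\<in>U. \<forall>y\<in>S. x \<le> y \<longrightarrow> y \<in> U))"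

lemma openin_upset_topology:
  "openin (upset_topology S) U \<longleftrightarrow> U \<subseteq> S \<and> (\<forall>x\<in>U. \<forall>y\<in>S. x \<le> y \<longrightarrow> y \<in> U)"
proof -
  have "istopology (\<lambda>U. U \<subseteq> S \<and> (\<forall>x\<in>U. \<forall>y\<in>S. x \<le> y \<longrightarrow> y \<in> U))"
    unfolding istopology_def by blast
  then show ?thesis
    by (simp add: upset_topology_def)
qed

lemma topspace_upset_topology [simp]: "topspace (upset_topology S) = S"
  by (auto simp: topspace_def openin_upset_topology)

definition max_elements :: "'a::order set \<Rightarrow> 'a set" where
  "max_elements S = {x \<in> S. \<forall>y\<in>S. x \<le> y \<longrightarrow> y = x}"

definition down_set :: "'a::order set \<Rightarrow> 'a \<Rightarrow> 'a set" where
  "down_set S a = {c \<in> S. c \<le> a}"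

definition covered_by :: "'a::order set \<Rightarrow> 'a \<Rightarrow> 'a \<Rightarrow> bool" where
  "covered_by S a c \<longleftrightarrow> a \<in> S \<and> c \<in> S \<and> a < c \<and> \<not> (\<exists>b\<in>S. a < b \<and> b < c)"

definition poset_morphism :: "'a::order set \<Rightarrow> 'b::order set \<Rightarrow> ('a \<Rightarrow> 'b) \<Rightarrow> bool" where
  "poset_morphism S D f \<longleftrightarrow> f ` S \<subseteq> D \<and> mono_on S f"

definition poset_isomorphism :: "'a::order set \<Rightarrow> 'b::order set \<Rightarrow> ('a \<Rightarrow> 'b) \<Rightarrow> bool" where
  "poset_isomorphism S D f \<longleftrightarrow>
     bij_betw f S D \<and> (\<forall>x\<in>S. \<forall>y\<in>S. x \<le> y \<longleftrightarrow> f x \<le> f y)"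

definition combinatorial :: "'a::order set \<Rightarrow> 'b::order set \<Rightarrow> ('a \<Rightarrow> 'b) \<Rightarrow> bool" where
  "combinatorial S D f \<longleftrightarrow>
     poset_morphism S D f \<and> finite S \<and> finite D \<and>
     (\<forall>a\<in>S. poset_isomorphism (down_set S a) (down_set D (f a)) f)"

definition balanced :: "'a::order set \<Rightarrow> 'b::order set \<Rightarrow> ('a \<Rightarrow> 'b) \<Rightarrow> ('a \<Rightarrow> int) \<Rightarrow> bool" where
  "balanced S D f m \<longleftrightarrow>
     (\<forall>a\<in>S. \<forall>b\<in>D. covered_by D (f a) b \<longrightarrow>
        m a = (\<Sum>c\<in>{c \<in> S. f c = b \<and> covered_by S a c}. m c))"

text \<open>
  A cover need not be surjective: the disjoint union of copies of \<open>U\<close> may be empty. This differs from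
  \<^const>\<open>covering_space\<close>. Openness of the sheets makes the union a topological disjoint union.
\<close>

definition is_cover :: "'a topology \<Rightarrow> 'b topology \<Rightarrow> ('a \<Rightarrow> 'b) \<Rightarrow> bool" where
  "is_cover X Y F \<longleftrightarrow>
     continuous_map X Y F \<and>
     (\<forall>y\<in>topspace Y. \<exists>U. openin Y U \<and> y \<in> U \<and>
        (\<exists>\<V>. \<Union>\<V> = {x \<in> topspace X. F x \<in> U} \<and> pairwise disjnt \<V> \<and>
           (\<forall>V\<in>\<V>. openin X V \<and>
              homeomorphic_map (subtopology X V) (subtopology Y U) F)))"

definition is_branched_cover ::
  "'a topology \<Rightarrow> 'b topology \<Rightarrow> 'b set \<Rightarrow> ('a \<Rightarrow> 'b) \<Rightarrow> bool" where
  "is_branched_cover X Y B F \<longleftrightarrow>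
     continuous_map X Y F \<and> closedin Y B \<and>
     openin Y (topspace Y - B) \<and> Y closure_of (topspace Y - B) = topspace Y \<and>
     is_cover (subtopology X {x \<in> topspace X. F x \<in> topspace Y - B})
       (subtopology Y (topspace Y - B)) F"

definition local_degree :: "('a \<Rightarrow> 'b) \<Rightarrow> ('a \<Rightarrow> int) \<Rightarrow> 'a set \<Rightarrow> 'b \<Rightarrow> int" where
  "local_degree F m V y = (\<Sum>x\<in>{x \<in> V. F x = y}. m x)"

definition is_indexed_branched_cover ::
  "'a topology \<Rightarrow> 'b topology \<Rightarrow> 'b set \<Rightarrow> ('a \<Rightarrow> 'b) \<Rightarrow> ('a \<Rightarrow> int) \<Rightarrow> bool" where
  "is_indexed_branched_cover X Y B F m \<longleftrightarrow>
     is_branched_cover X Y B F \<and>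
     (\<forall>y\<in>topspace Y. finite {x \<in> topspace X. F x = y}) \<and>
     (\<forall>x\<in>topspace X. 1 \<le> m x) \<and>
     (\<forall>U. openin Y U \<and> connectedin Y U \<longrightarrow>
        (\<forall>V\<in>connected_components_of (subtopology X {x \<in> topspace X. F x \<in> U}).
           local_degree F m V constant_on U))"

end

theory Submission
  imports Defs
begin

text \<open>
  Write \<open>\<up>a\<close> for the set of elements above \<open>a\<close>. A combinatorial morphism \<open>f\<close> lifts lower sets
  uniquely: every \<open>c\<close> with \<open>b \<le> f c\<close> has exactly one element below it in the fibre over \<open>b\<close>
  (\<open>combinatorial_lift\<close>). Both directions of the equivalence rest on this.

  For the necessity of balancing, take \<open>U = \<up>(f a)\<close>, which is open and connected. By
  unique lifting, the sets \<open>\<up>a'\<close>, for \<open>a'\<close> in the fibre over \<open>f a\<close>, partition the preimage of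
  \<open>U\<close>; they are open and connected, so they are its connected components. On the component
  \<open>\<up>a\<close>, the degree at \<open>f a\<close> is \<open>m a\<close>, and the degree at a cover \<open>b\<close> of \<open>f a\<close> is the sum in the
  balancing condition; so constancy of the degree is balancing at \<open>a\<close>.

  For sufficiency, the branch locus is the complement of the set of maximal elements; over maximal
  elements \<open>f\<close> is a map of discrete spaces, hence a cover. Let \<open>V\<close> be a component of the preimage of \<open>U\<close>. Comparable elements of the
  preimage lie in the same component, so unique lifting distributes the elements of \<open>V\<close> over \<open>y'\<close>
  among those over \<open>y\<close> whenever \<open>y'\<close> covers \<open>y\<close>, and summing the balancing condition gives equal
  degrees at \<open>y\<close> and \<open>y'\<close> (\<open>balanced_local_degree_step\<close>). As \<open>U\<close> is finite and up-closed,
  comparable elements of \<open>U\<close> are joined by chains of covers inside \<open>U\<close>. Hence the level sets of the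
  degree are closed under going up and down, and connectedness of \<open>U\<close> leaves only one.
\<close>

section \<open>The up-set topology\<close>

text \<open>
  The carrier \<open>A\<close> is arbitrary: an up-set of \<open>A\<close> is the trace of the up-set it generates in \<open>S\<close>.
\<close>

lemma subtopology_upset_topology:
  assumes "A \<subseteq> S"
  shows "subtopology (upset_topology S) A = upset_topology A"
proof -
  have "openin (subtopology (upset_topology S) A) W \<longleftrightarrow> openin (upset_topology A) W" for W
  proof
    assume "openin (subtopology (upset_topology S) A) W"
    then show "openin (upset_topology A) W"
      using assms by (auto simp: openin_subtopology openin_upset_topology)
  next
    assume W: "openin (upset_topology A) W"
    let ?U = "{y \<in> S. \<exists>x\<in>W. x \<le> y}"
    have "W = ?U \<inter> A"
      using W assms by (auto simp: openin_upset_topology)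
    moreover have "openin (upset_topology S) ?U"
      by (auto simp: openin_upset_topology intro: order_trans)
    ultimately show "openin (subtopology (upset_topology S) A) W"
      by (auto simp: openin_subtopology)
  qed
  then show ?thesis
    by (simp add: topology_eq)
qed

lemma continuous_map_upset_topology:
  assumes "poset_morphism S D f"
  shows "continuous_map (upset_topology S) (upset_topology D) f"
  using assms
  by (auto simp: continuous_map_def openin_upset_topology poset_morphism_def image_subset_iff
      dest: mono_onD)

text \<open>
  The complement of an up-set is a down-set, so a clopen set is one that contains both or neither of
  any two comparable elements.
\<close>

lemma connected_upset_topology_iff:
  "connected_space (upset_topology S) \<longleftrightarrow>
     (\<forall>T\<subseteq>S. (\<forall>x\<in>S. \<forall>y\<in>S. x \<le> y \<longrightarrow> (x \<in> T \<longleftrightarrow> y \<in> T)) \<longrightarrow> T = {} \<or> T = S)"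
proof -
  have clopen: "openin (upset_topology S) T \<and> closedin (upset_topology S) T \<longleftrightarrow>
      T \<subseteq> S \<and> (\<forall>x\<in>S. \<forall>y\<in>S. x \<le> y \<longrightarrow> (x \<in> T \<longleftrightarrow> y \<in> T))" for T
    unfolding closedin_def openin_upset_topology topspace_upset_topology
    by (intro iffI; elim conjE; intro conjI ballI impI iffI; blast)
  show ?thesis
    unfolding connected_space_clopen_in clopen topspace_upset_topology imp_conjL ..
qed

lemma connectedin_principal_upset:
  assumes "a \<in> S"
  shows "connectedin (upset_topology S) {c \<in> S. a \<le> c}"
proof -
  let ?A = "{c \<in> S. a \<le> c}"
  have "connected_space (upset_topology ?A)"
    unfolding connected_upset_topology_iff
  proof (intro allI impI)
    fix T assume "T \<subseteq> ?A" and T: "\<forall>x\<in>?A. \<forall>y\<in>?A. x \<le> y \<longrightarrow> (x \<in> T \<longleftrightarrow> y \<in> T)"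
    have "a \<in> T \<longleftrightarrow> x \<in> T" if "x \<in> ?A" for x
      using T[rule_format, of a x] that assms by simp
    then show "T = {} \<or> T = ?A"
      using \<open>T \<subseteq> ?A\<close> by (cases "a \<in> T") auto
  qed
  then show ?thesis
    by (auto simp: connectedin_def subtopology_upset_topology)
qed

lemma component_upset_topology_comparable:
  assumes "V \<in> connected_components_of (upset_topology A)" "x \<in> A" "y \<in> A" "x \<le> y"
  shows "x \<in> V \<longleftrightarrow> y \<in> V"
proof -
  let ?C = "{c \<in> A. x \<le> c}"
  have "?C \<subseteq> V" if "\<not> disjnt V ?C"
    using connected_components_of_maximal[OF assms(1) connectedin_principal_upset] assms(2) that
    by blast
  then show ?thesis
    using assms(2-4) by (auto simp: disjnt_def)
qed

text \<open>
  A principal up-set is connected and open, so being closed under going down makes it a component.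
\<close>

lemma principal_upset_in_components:
  assumes a: "a \<in> A"
    and closed: "\<And>x y. \<lbrakk>x \<in> A; y \<in> A; a \<le> y; x \<le> y\<rbrakk> \<Longrightarrow> a \<le> x"
  shows "{c \<in> A. a \<le> c} \<in> connected_components_of (upset_topology A)"
proof -
  let ?C = "{c \<in> A. a \<le> c}" and ?K = "connected_component_of_set (upset_topology A) a"
  have K: "?K \<in> connected_components_of (upset_topology A)"
    using a by (simp add: connected_component_in_connected_components_of)
  have "a \<in> ?K"
    using a by (simp add: connected_component_of_refl)
  then have "?C \<subseteq> ?K"
    using component_upset_topology_comparable[OF K] a by blast
  moreover have "?K \<subseteq> ?C"
  proof -
    have sub: "?K \<subseteq> A"
      using connected_component_of_subset_topspace[of "upset_topology A" a] by simp
    have "connected_space (upset_topology ?K)"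
      using connectedin_connected_component_of[of "upset_topology A" a] sub
      by (simp add: connectedin_def subtopology_upset_topology)
    moreover have "\<forall>x\<in>?K. \<forall>y\<in>?K. x \<le> y \<longrightarrow> (x \<in> ?C \<longleftrightarrow> y \<in> ?C)"
      using sub closed by (blast intro: order_trans)
    ultimately have "?C = {} \<or> ?C = ?K"
      using \<open>?C \<subseteq> ?K\<close> unfolding connected_upset_topology_iff by blast
    then show ?thesis
      using a by blast
  qed
  ultimately show ?thesis
    using K by simp
qed

section \<open>Combinatorial morphisms\<close>

lemma combinatorial_lift:
  assumes "combinatorial S D f" "c \<in> S" "b \<in> D" "b \<le> f c"
  shows "\<exists>!a. a \<in> S \<and> a \<le> c \<and> f a = b"
proof -
  have bij: "bij_betw f (down_set S c) (down_set D (f c))"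
    using assms by (auto simp: combinatorial_def poset_isomorphism_def)
  have "b \<in> f ` down_set S c"
    using bij assms(3,4) by (simp add: bij_betw_def down_set_def)
  moreover have "inj_on f (down_set S c)"
    using bij by (simp add: bij_betw_def)
  ultimately show ?thesis
    by (auto simp: down_set_def inj_on_def)
qed

lemma combinatorial_mem:
  "combinatorial S D f \<Longrightarrow> a \<in> S \<Longrightarrow> f a \<in> D"
  by (auto simp: combinatorial_def poset_morphism_def)

lemma combinatorial_mono:
  "combinatorial S D f \<Longrightarrow> a \<in> S \<Longrightarrow> c \<in> S \<Longrightarrow> a \<le> c \<Longrightarrow> f a \<le> f c"
  by (auto simp: combinatorial_def poset_morphism_def dest: mono_onD)

lemma combinatorial_strict_mono:
  assumes "combinatorial S D f" "a \<in> S" "c \<in> S" "a < c"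
  shows "f a < f c"
proof -
  have "f a \<noteq> f c"
    using combinatorial_lift[OF assms(1,3), of "f c"] combinatorial_mem[OF assms(1,3)] assms(2-4)
    by force
  then show ?thesis
    using combinatorial_mono[OF assms(1-3)] assms(4) by (simp add: less_le)
qed

text \<open>
  Strict monotonicity forbids elements strictly between \<open>a\<close> and \<open>c\<close> when \<open>f c\<close> covers \<open>f a\<close>, so in
  the balancing condition the covering relation may be replaced by the order.
\<close>

lemma combinatorial_covers_over:
  assumes "combinatorial S D f" "a \<in> S" "covered_by D (f a) b"
  shows "{c \<in> S. f c = b \<and> covered_by S a c} = {c \<in> S. f c = b \<and> a \<le> c}"
proof -
  have "covered_by S a c" if c: "c \<in> S" "f c = b" "a \<le> c" for c
  proof -
    have "a \<noteq> c"
      using assms(3) c by (auto simp: covered_by_def)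
    then have "a < c"
      using c(3) by simp
    moreover have "\<not> (a < d \<and> d < c)" if "d \<in> S" for d
    proof
      assume d: "a < d \<and> d < c"
      have "f a < f d" "f d < b"
        using combinatorial_strict_mono[OF assms(1)] assms(2) c that d by blast+
      then show False
        using combinatorial_mem[OF assms(1) that] assms(3) unfolding covered_by_def by blast
    qed
    ultimately show ?thesis
      using assms(2) c by (auto simp: covered_by_def)
  qed
  then show ?thesis
    by (auto simp: covered_by_def)
qed

lemma combinatorial_balanced_iff:
  assumes "combinatorial S D f"
  shows "balanced S D f m \<longleftrightarrow>
    (\<forall>a\<in>S. \<forall>b\<in>D. covered_by D (f a) b \<longrightarrow> m a = (\<Sum>c\<in>{c \<in> S. f c = b \<and> a \<le> c}. m c))"
  unfolding balanced_def by (simp add: combinatorial_covers_over[OF assms] cong: imp_cong)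

lemma combinatorial_max_fibre:
  assumes "combinatorial S D f" "a \<in> S" "f a \<in> max_elements D"
  shows "a \<in> max_elements S"
proof -
  have "c = a" if "c \<in> S" "a \<le> c" for c
  proof -
    have "f c = f a"
      using combinatorial_mem[OF assms(1) that(1)] combinatorial_mono[OF assms(1,2) that] assms(3)
      by (simp add: max_elements_def)
    then show ?thesis
      using combinatorial_strict_mono[OF assms(1,2) that(1)] that(2)
      by (auto simp: order.order_iff_strict)
  qed
  then show ?thesis
    using assms(2) by (simp add: max_elements_def)
qed

section \<open>Constant degree implies balanced\<close>

text \<open>
  In the preimage, \<open>\<up>a\<close> is closed under going down: below an element above \<open>a\<close>, an element \<open>x\<close> of the
  preimage has a lift of \<open>f a\<close>, and this lift is \<open>a\<close> by uniqueness.
\<close>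

lemma principal_upset_component_of_preimage:
  assumes comb: "combinatorial S D f" and a: "a \<in> S"
  shows "{c \<in> S. a \<le> c} \<in> connected_components_of (upset_topology {x \<in> S. f a \<le> f x})"
proof -
  have "a \<le> x" if x: "x \<in> S" "f a \<le> f x" and y: "y \<in> S" "a \<le> y" "x \<le> y" for x y
  proof -
    obtain a' where a': "a' \<in> S" "a' \<le> x" "f a' = f a"
      using combinatorial_lift[OF comb x(1) combinatorial_mem[OF comb a] x(2)] by blast
    have "a' \<le> y"
      using a'(2) y(3) by (rule order_trans)
    then have "a' = a"
      using combinatorial_lift[OF comb y(1) combinatorial_mem[OF comb a]
          combinatorial_mono[OF comb a y(1,2)]] a a' y(2)
      by blast
    then show ?thesis
      using a' by simp
  qed
  then have "{c \<in> {x \<in> S. f a \<le> f x}. a \<le> c} \<in>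
      connected_components_of (upset_topology {x \<in> S. f a \<le> f x})"
    using a by (intro principal_upset_in_components) auto
  moreover have "{c \<in> {x \<in> S. f a \<le> f x}. a \<le> c} = {c \<in> S. a \<le> c}"
    using combinatorial_mono[OF comb a] by auto
  ultimately show ?thesis
    by simp
qed

lemma indexed_branched_cover_imp_balanced:
  assumes comb: "combinatorial S D f"
    and cover: "is_indexed_branched_cover (upset_topology S) (upset_topology D) B f m"
  shows "balanced S D f m"
  unfolding combinatorial_balanced_iff[OF comb]
proof (intro ballI impI)
  fix a b
  assume a: "a \<in> S" and b: "b \<in> D" and cov: "covered_by D (f a) b"
  let ?U = "{y \<in> D. f a \<le> y}" and ?V = "{c \<in> S. a \<le> c}"
  have U: "openin (upset_topology D) ?U" "connectedin (upset_topology D) ?U"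
    using connectedin_principal_upset[OF combinatorial_mem[OF comb a]]
    by (auto simp: openin_upset_topology intro: order_trans)
  have "{x \<in> S. f x \<in> ?U} = {x \<in> S. f a \<le> f x}"
    using combinatorial_mem[OF comb] by auto
  then have "?V \<in> connected_components_of
      (subtopology (upset_topology S) {x \<in> topspace (upset_topology S). f x \<in> ?U})"
    using principal_upset_component_of_preimage[OF comb a]
    by (simp add: subtopology_upset_topology)
  then have "local_degree f m ?V constant_on ?U"
    using cover U unfolding is_indexed_branched_cover_def by blast
  moreover have "f a \<in> ?U" "b \<in> ?U"
    using combinatorial_mem[OF comb a] b cov by (auto simp: covered_by_def)
  ultimately have "local_degree f m ?V (f a) = local_degree f m ?V b"
    by (metis (no_types, lifting) constant_on_def)
  moreover have "{c \<in> ?V. f c = f a} = {a}"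
    using combinatorial_strict_mono[OF comb a] a by (force simp: order.order_iff_strict)
  moreover have "{c \<in> ?V. f c = b} = {c \<in> S. f c = b \<and> a \<le> c}"
    by auto
  ultimately show "m a = (\<Sum>c\<in>{c \<in> S. f c = b \<and> a \<le> c}. m c)"
    by (simp add: local_degree_def)
qed

section \<open>Balanced implies constant degree\<close>

text \<open>
  Balancing writes the degree at \<open>y\<close> as a double sum over \<open>x\<close> in the fibre and \<open>c\<close> above \<open>x\<close>;
  since each \<open>c\<close> over \<open>y'\<close> lies above exactly one \<open>x\<close> over \<open>y\<close>, this is the degree at \<open>y'\<close>.
\<close>

lemma balanced_local_degree_step:
  assumes comb: "combinatorial S D f" and bal: "balanced S D f m"
    and cov: "covered_by D y y'" and "V \<subseteq> S"
    and V: "\<And>x c. \<lbrakk>x \<in> S; c \<in> S; f x = y; f c = y'; x \<le> c\<rbrakk> \<Longrightarrow> x \<in> V \<longleftrightarrow> c \<in> V"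
  shows "local_degree f m V y = local_degree f m V y'"
proof -
  let ?F = "{x \<in> V. f x = y}" and ?G = "\<lambda>x. {c \<in> S. f c = y' \<and> x \<le> c}"
  have fin: "finite S"
    using comb by (simp add: combinatorial_def)
  have y: "y \<in> D" "y' \<in> D" "y \<le> y'"
    using cov by (auto simp: covered_by_def)
  have lift: "\<exists>!x. x \<in> S \<and> x \<le> c \<and> f x = y" if "c \<in> S" "f c = y'" for c
    using combinatorial_lift[OF comb that(1) y(1)] y(3) that(2) by simp
  have "local_degree f m V y = (\<Sum>x\<in>?F. \<Sum>c\<in>?G x. m c)"
    unfolding local_degree_def
  proof (rule sum.cong)
    fix x assume "x \<in> ?F"
    then show "m x = (\<Sum>c\<in>?G x. m c)"
      using bal cov y(2) \<open>V \<subseteq> S\<close> unfolding combinatorial_balanced_iff[OF comb] by blast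
  qed simp
  also have "\<dots> = (\<Sum>c\<in>(\<Union>x\<in>?F. ?G x). m c)"
  proof (rule sum.UNION_disjoint[symmetric])
    show "finite ?F"
      using fin \<open>V \<subseteq> S\<close> by (auto intro: finite_subset)
    show "\<forall>x\<in>?F. finite (?G x)"
      using fin by simp
    show "\<forall>x\<in>?F. \<forall>x'\<in>?F. x \<noteq> x' \<longrightarrow> ?G x \<inter> ?G x' = {}"
      using lift \<open>V \<subseteq> S\<close> by blast
  qed
  also have "(\<Union>x\<in>?F. ?G x) = {c \<in> V. f c = y'}"
  proof
    show "(\<Union>x\<in>?F. ?G x) \<subseteq> {c \<in> V. f c = y'}"
      using V \<open>V \<subseteq> S\<close> by blast
    show "{c \<in> V. f c = y'} \<subseteq> (\<Union>x\<in>?F. ?G x)"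
    proof
      fix c assume c: "c \<in> {c \<in> V. f c = y'}"
      then obtain x where "x \<in> S" "x \<le> c" "f x = y"
        using lift \<open>V \<subseteq> S\<close> by blast
      then show "c \<in> (\<Union>x\<in>?F. ?G x)"
        using V[of x c] c \<open>V \<subseteq> S\<close> by blast
    qed
  qed
  finally show ?thesis
    by (simp add: local_degree_def)
qed

lemma invariant_along_covers:
  assumes "finite D" "x \<in> D" "y \<in> D" "x \<le> y"
    and step: "\<And>a b. \<lbrakk>covered_by D a b; x \<le> a; b \<le> y\<rbrakk> \<Longrightarrow> g a = g b"
  shows "g x = g y"
  using assms(2-)
proof (induction "card {z \<in> D. x \<le> z \<and> z \<le> y}" arbitrary: x y rule: less_induct)
  case less
  show ?case
  proof (cases "x = y \<or> covered_by D x y")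
    case True
    then show ?thesis
      using less.prems(4)[of x y] by auto
  next
    case False
    then obtain b where b: "b \<in> D" "x < b" "b < y"
      using less.prems(1-3) by (auto simp: covered_by_def)
    have "{z \<in> D. x \<le> z \<and> z \<le> b} \<subset> {z \<in> D. x \<le> z \<and> z \<le> y}"
    proof (rule psubsetI)
      have "y \<in> {z \<in> D. x \<le> z \<and> z \<le> y}" "y \<notin> {z \<in> D. x \<le> z \<and> z \<le> b}"
        using b less.prems(2,3) by auto
      then show "{z \<in> D. x \<le> z \<and> z \<le> b} \<noteq> {z \<in> D. x \<le> z \<and> z \<le> y}"
        by blast
    qed (use b in auto)
    moreover have "{z \<in> D. b \<le> z \<and> z \<le> y} \<subset> {z \<in> D. x \<le> z \<and> z \<le> y}"
    proof (rule psubsetI)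
      have "x \<in> {z \<in> D. x \<le> z \<and> z \<le> y}" "x \<notin> {z \<in> D. b \<le> z \<and> z \<le> y}"
        using b less.prems(1,3) by auto
      then show "{z \<in> D. b \<le> z \<and> z \<le> y} \<noteq> {z \<in> D. x \<le> z \<and> z \<le> y}"
        by blast
    qed (use b in auto)
    ultimately have "card {z \<in> D. x \<le> z \<and> z \<le> b} < card {z \<in> D. x \<le> z \<and> z \<le> y}"
      "card {z \<in> D. b \<le> z \<and> z \<le> y} < card {z \<in> D. x \<le> z \<and> z \<le> y}"
      using \<open>finite D\<close> by (auto intro!: psubset_card_mono)
    moreover have "g a = g c" if "covered_by D a c" "x \<le> a" "c \<le> b" for a c
      using less.prems(4)[of a c] that b by auto
    moreover have "g a = g c" if "covered_by D a c" "b \<le> a" "c \<le> y" for a c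
      using less.prems(4)[of a c] that b by auto
    ultimately have "g x = g b" "g b = g y"
      using less.hyps[of x b] less.hyps[of b y] b less.prems(1,2) by (auto simp: less_imp_le)
    then show ?thesis
      by simp
  qed
qed

lemma balanced_local_degree_constant:
  assumes comb: "combinatorial S D f" and bal: "balanced S D f m"
    and U: "openin (upset_topology D) U" "connectedin (upset_topology D) U"
    and V: "V \<in> connected_components_of (upset_topology {x \<in> S. f x \<in> U})"
  shows "local_degree f m V constant_on U"
proof -
  let ?d = "local_degree f m V"
  have UD: "U \<subseteq> D" and up: "\<And>x y. \<lbrakk>x \<in> U; y \<in> D; x \<le> y\<rbrakk> \<Longrightarrow> y \<in> U"
    using U(1) by (auto simp: openin_upset_topology)
  have "V \<subseteq> {x \<in> S. f x \<in> U}"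
    using connected_components_of_subset[OF V] by simp
  then have VS: "V \<subseteq> S"
    by blast
  have comparable: "?d x = ?d y" if xy: "x \<in> U" "y \<in> U" "x \<le> y" for x y
  proof (rule invariant_along_covers[where g = ?d and x = x and y = y])
    show "finite D"
      using comb by (simp add: combinatorial_def)
    show "x \<in> D" "y \<in> D" "x \<le> y"
      using xy UD by auto
    fix a b assume ab: "covered_by D a b" "x \<le> a" "b \<le> y"
    then have "a \<in> D" "b \<in> D" "a \<le> b"
      by (auto simp: covered_by_def)
    then have "a \<in> U" "b \<in> U"
      using up[OF xy(1) _ ab(2)] up by blast+
    then show "?d a = ?d b"
      by (intro balanced_local_degree_step[OF comb bal ab(1) VS]
          component_upset_topology_comparable[OF V]) simp_all
  qed
  have conn: "connected_space (upset_topology U)"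
    using U(2) UD by (simp add: connectedin_def subtopology_upset_topology)
  have "?d y = ?d z" if yz: "y \<in> U" "z \<in> U" for y z
  proof -
    define T where "T = {x \<in> U. ?d x = ?d z}"
    have "T \<subseteq> U"
      by (auto simp: T_def)
    moreover have "\<forall>x\<in>U. \<forall>x'\<in>U. x \<le> x' \<longrightarrow> (x \<in> T \<longleftrightarrow> x' \<in> T)"
    proof (intro ballI impI)
      fix x x' assume "x \<in> U" "x' \<in> U" "x \<le> x'"
      then show "x \<in> T \<longleftrightarrow> x' \<in> T"
        using comparable[of x x'] by (simp add: T_def)
    qed
    ultimately have "T = {} \<or> T = U"
      by (rule conn[unfolded connected_upset_topology_iff, THEN spec, THEN mp, THEN mp])
    moreover have "z \<in> T"
      using yz(2) by (simp add: T_def)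
    ultimately have "y \<in> T"
      using yz(1) by auto
    then show ?thesis
      by (simp add: T_def)
  qed
  then show ?thesis
    unfolding constant_on_def by metis
qed

section \<open>The branched cover\<close>

text \<open>
  Over the maximal elements both spaces are discrete, so single points serve as sheets. Density of
  the maximal elements is where finiteness of the target enters.
\<close>

lemma combinatorial_branched_cover:
  assumes comb: "combinatorial S D f"
  shows "is_branched_cover (upset_topology S) (upset_topology D) (D - max_elements D) f"
proof -
  let ?M = "max_elements D" and ?P = "{x \<in> S. f x \<in> max_elements D}"
  have MD: "?M \<subseteq> D" and fin: "finite D"
    using comb by (auto simp: max_elements_def combinatorial_def)
  then have compl: "D - (D - ?M) = ?M"
    by blast
  have cont: "continuous_map (upset_topology S) (upset_topology D) f"
    using comb by (simp add: combinatorial_def continuous_map_upset_topology)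
  have opn: "openin (upset_topology D) ?M"
    by (auto simp: openin_upset_topology max_elements_def)
  have dense: "upset_topology D closure_of ?M = D"
  proof
    show "D \<subseteq> upset_topology D closure_of ?M"
    proof
      fix x assume x: "x \<in> D"
      then obtain z where z: "z \<in> D" "x \<le> z" "\<forall>b\<in>D. z \<le> b \<longrightarrow> z = b"
        using finite_has_maximal2[OF fin] by blast
      then have "z \<in> ?M"
        by (auto simp: max_elements_def)
      then show "x \<in> upset_topology D closure_of ?M"
        using x z by (auto simp: in_closure_of openin_upset_topology)
    qed
  qed (use closure_of_subset_topspace[of "upset_topology D" ?M] in simp)
  have "is_cover (upset_topology ?P) (upset_topology ?M) f"
    unfolding is_cover_def
  proof (intro conjI ballI)
    show "continuous_map (upset_topology ?P) (upset_topology ?M) f"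
      using continuous_map_upset_topology[of ?P ?M f] combinatorial_mono[OF comb]
      by (auto simp: poset_morphism_def mono_on_def)
    fix y assume "y \<in> topspace (upset_topology ?M)"
    then have y: "y \<in> ?M"
      by simp
    let ?\<V> = "(\<lambda>x. {x}) ` {x \<in> S. f x = y}"
    have "openin (upset_topology ?M) {y}"
      using y by (auto simp: openin_upset_topology max_elements_def)
    moreover have "\<Union>?\<V> = {x \<in> topspace (upset_topology ?P). f x \<in> {y}}"
      using y by auto
    moreover have "pairwise disjnt ?\<V>"
      by (auto simp: pairwise_def)
    moreover have "openin (upset_topology ?P) {x} \<and>
        homeomorphic_map (subtopology (upset_topology ?P) {x}) (subtopology (upset_topology ?M) {y}) f"
      if x: "x \<in> S" "f x = y" for x
    proof
      have "x \<in> max_elements S"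
        using combinatorial_max_fibre[OF comb x(1)] x(2) y by simp
      then show "openin (upset_topology ?P) {x}"
        using x y by (auto simp: openin_upset_topology max_elements_def)
      have "homeomorphic_maps (upset_topology {x}) (upset_topology {y}) f (\<lambda>_. x)"
        using x(2) by (auto simp: homeomorphic_maps_def poset_morphism_def mono_on_def
            intro!: continuous_map_upset_topology)
      then show "homeomorphic_map (subtopology (upset_topology ?P) {x})
          (subtopology (upset_topology ?M) {y}) f"
        using x y by (auto simp: subtopology_upset_topology homeomorphic_map_maps)
    qed
    ultimately show "\<exists>U. openin (upset_topology ?M) U \<and> y \<in> U \<and>
        (\<exists>\<V>. \<Union>\<V> = {x \<in> topspace (upset_topology ?P). f x \<in> U} \<and> pairwise disjnt \<V> \<and>
          (\<forall>V\<in>\<V>. openin (upset_topology ?P) V \<and> homeomorphic_map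
            (subtopology (upset_topology ?P) V) (subtopology (upset_topology ?M) U) f))"
      by (intro exI[of _ "{y}"] exI[of _ ?\<V>] conjI) auto
  qed
  then show ?thesis
    unfolding is_branched_cover_def
    using cont opn dense MD by (simp add: compl closedin_def subtopology_upset_topology)
qed

lemma balanced_imp_indexed_branched_cover:
  assumes comb: "combinatorial S D f" and pos: "\<forall>x\<in>S. 1 \<le> m x" and bal: "balanced S D f m"
  shows "is_indexed_branched_cover (upset_topology S) (upset_topology D) (D - max_elements D) f m"
  unfolding is_indexed_branched_cover_def
  using combinatorial_branched_cover[OF comb] balanced_local_degree_constant[OF comb bal] pos comb
  by (simp add: subtopology_upset_topology combinatorial_def)

theorem mainTheorem2:
  fixes \<Sigma> :: "'a::order set" and \<Delta> :: "'b::order set"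
    and \<phi> :: "'a \<Rightarrow> 'b" and m :: "'a \<Rightarrow> int"
  assumes "combinatorial \<Sigma> \<Delta> \<phi>"
    and "\<forall>x\<in>\<Sigma>. 1 \<le> m x"
    and "connected_space (upset_topology \<Delta>)"
  shows "(\<exists>B. B \<subseteq> \<Delta> - max_elements \<Delta> \<and>
            is_indexed_branched_cover (upset_topology \<Sigma>) (upset_topology \<Delta>) B \<phi> m)
         \<longleftrightarrow> balanced \<Sigma> \<Delta> \<phi> m"
  using indexed_branched_cover_imp_balanced[OF assms(1)]
    balanced_imp_indexed_branched_cover[OF assms(1,2)]
  by blast

end
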